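(* For $i=1,2$ let $\mathcal L_i=\langle C_i,\models_{M_i}\rangle$ be matrix logics, where $M_i=(\mathbf A_i,D_i)$ is a $C_i$-matrix with universe $A_i$, and let $(\lambda,\mu)$ be an admissible pair. Then $[\mathcal L_1\odot\mathcal L_2]_{(\lambda,\mu)}$ is a strong conservative extension of both logics: for each $i\in\{1,2\}$ and every $\Gamma\cup\{\varphi\}\subseteq L(C_i)$, $\Gamma\models_{M_i}\varphi$ if and only if $\Gamma\models_{(M_1\circledast M_2)_{(\lambda,\mu)}}\varphi$.
   Context: Fix a countable set $\mathcal V=\{p_1,p_2,\dots\}$ of propositional variables. A signature $C=\{C^k\}_{k\in\mathbb N}$ is a family of pairwise disjoint sets, disjoint from $\mathcal V$ ($C^k$ is the set of $k$-ary connectives); $L(C)$ is the absolutely free algebra over $C$ generated by $\mathcal V$. A $C$-matrix is $M=(\mathbf A,D)$ with $\mathbf A$ a $C$-algebra with universe $A$ and $D\subseteq A$. An $M$-valuation is a homomorphism $v:L(C)\to\mathbf A$. $\Gamma\models_M\varphi$ means: for every $M$-valuation $v$, $v(\Gamma)\subseteq D$ implies $v(\varphi)\in D$. A matrix logic here is a pair $\langle C,\models_M\rangle$. A fibring pair is $(\lambda,\mu)$ with $\lambda:A_1\to A_2$, $\mu:A_2\to A_1$. It is admissible if for every $x\in A_1$: $\lambda(x)\in D_2$ iff $x\in D_1$; and for every $y\in A_2$: $\mu(y)\in D_1$ iff $y\in D_2$. Put $C_\circledast=C_1\uplus C_2$, $A_\circledast=A_1\uplus A_2$, $D_\circledast=D_1\uplus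 D_2$ (disjoint unions; $L(C_i)$ is regarded as a subset of $L(C_\circledast)$). Define $\ast_\lambda:A_\circledast\to A_2$ by $\ast_\lambda(x)=\lambda(x)$ if $x\in A_1$, $\ast_\lambda(x)=x$ if $x\in A_2$; and $\ast_\mu:A_\circledast\to A_1$ by $\ast_\mu(x)=x$ if $x\in A_1$, $\ast_\mu(x)=\mu(x)$ if $x\in A_2$. The fibred $C_\circledast$-matrix $(M_1\circledast M_2)_{(\lambda,\mu)}$ has universe $A_\circledast$, designated set $D_\circledast$, and operations $c(x_1,\dots,x_k)=c^{\mathbf A_1}(\ast_\mu(x_1),\dots,\ast_\mu(x_k))$ for $c\in C_1^k$ and $c(x_1,\dots,x_k)=c^{\mathbf A_2}(\ast_\lambda(x_1),\dots,\ast_\lambda(x_k))$ for $c\in C_2^k$. For admissible $(\lambda,\mu)$, the logic $\langle C_\circledast,\models_{(M_1\circledast M_2)_{(\lambda,\mu)}}\rangle$ is denoted $[\mathcal L_1\odot\mathcal L_2]_{(\lambda,\mu)}$. *)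

theory Defs
  imports "HOL-Library.FuncSet" "HOL-Library.Disjoint_Sets"
begin

section \<open>Signatures and formulas\<close>

type_synonym 'c signature = "nat \<Rightarrow> 'c set"

definition is_signature :: "'c signature \<Rightarrow> bool" where
  "is_signature C \<longleftrightarrow> disjoint_family C"

text \<open>
  Raw terms: connectives may be applied to lists of any length, and \<open>L C\<close> selects the terms
  that respect the arities of \<open>C\<close>. The variable \<open>Var i\<close> is the \<open>i\<close>-th propositional variable
  (counting from 0); being a separate constructor, it is automatically disjoint from the connectives.
\<close>

datatype 'c fm = Var nat | App 'c "'c fm list"

inductive_set L :: "'c signature \<Rightarrow> 'c fm set" for C :: "'c signature" where
  Var: "Var i \<in> L C"
| App: "\<lbrakk>c \<in> C k; length ts = k; \<forall>t\<in>set ts. t \<in> L C\<rbrakk> \<Longrightarrow> App c ts \<in> L C"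

section \<open>Matrices and matrix logics\<close>

text \<open>
  The arity of a connective is determined by the connective, since the sets \<open>C k\<close> are pairwise
  disjoint; so one function on lists per connective suffices. The values of \<open>oper M c xs\<close> matter
  only for \<open>c \<in> C k\<close> and lists \<open>xs\<close> of length \<open>k\<close> over the universe.
\<close>

record ('c, 'a) matrix =
  universe :: "'a set"
  oper :: "'c \<Rightarrow> 'a list \<Rightarrow> 'a"
  designated :: "'a set"

definition is_matrix :: "'c signature \<Rightarrow> ('c, 'a) matrix \<Rightarrow> bool" where
  "is_matrix C M \<longleftrightarrow>
     (\<forall>k. \<forall>c\<in>C k. \<forall>xs. length xs = k \<and> set xs \<subseteq> universe M \<longrightarrow> oper M c xs \<in> universe M) \<and>
     designated M \<subseteq> universe M"

definition valuation :: "'c signature \<Rightarrow> ('c, 'a) matrix \<Rightarrow> ('c fm \<Rightarrow> 'a) \<Rightarrow> bool" where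
  "valuation C M v \<longleftrightarrow>
     v \<in> L C \<rightarrow> universe M \<and>
     (\<forall>k. \<forall>c\<in>C k. \<forall>ts. length ts = k \<and> set ts \<subseteq> L C \<longrightarrow> v (App c ts) = oper M c (map v ts))"

definition entails :: "'c signature \<Rightarrow> ('c, 'a) matrix \<Rightarrow> 'c fm set \<Rightarrow> 'c fm \<Rightarrow> bool" where
  "entails C M \<Gamma> \<phi> \<longleftrightarrow>
     \<Gamma> \<subseteq> L C \<and> \<phi> \<in> L C \<and>
     (\<forall>v. valuation C M v \<longrightarrow> v ` \<Gamma> \<subseteq> designated M \<longrightarrow> v \<phi> \<in> designated M)"

type_synonym 'c logic = "'c signature \<times> ('c fm set \<Rightarrow> 'c fm \<Rightarrow> bool)"

definition matrix_logic :: "'c signature \<Rightarrow> ('c, 'a) matrix \<Rightarrow> 'c logic" where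
  "matrix_logic C M = (C, entails C M)"

text \<open>
  Here \<open>e\<close> is the inclusion of the connectives of the first logic into those of the second; the
  first language is regarded as a subset of the second via the injection \<open>map_fm e\<close>.
  The extension is strong in that arbitrary, possibly infinite, sets of premises are allowed.
\<close>

definition strong_conservative_extension :: "('c \<Rightarrow> 'd) \<Rightarrow> 'c logic \<Rightarrow> 'd logic \<Rightarrow> bool" where
  "strong_conservative_extension e \<L> \<L>' \<longleftrightarrow>
     (\<forall>\<Gamma> \<phi>. \<Gamma> \<union> {\<phi>} \<subseteq> L (fst \<L>) \<longrightarrow>
        (snd \<L> \<Gamma> \<phi> \<longleftrightarrow> snd \<L>' (map_fm e ` \<Gamma>) (map_fm e \<phi>)))"

section \<open>Fibring\<close>

definition fibring_pair ::
    "('c, 'a) matrix \<Rightarrow> ('d, 'b) matrix \<Rightarrow> ('a \<Rightarrow> 'b) \<Rightarrow> ('b \<Rightarrow> 'a) \<Rightarrow> bool" where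
  "fibring_pair M1 M2 lam mu \<longleftrightarrow>
     lam \<in> universe M1 \<rightarrow> universe M2 \<and> mu \<in> universe M2 \<rightarrow> universe M1"

definition admissible ::
    "('c, 'a) matrix \<Rightarrow> ('d, 'b) matrix \<Rightarrow> ('a \<Rightarrow> 'b) \<Rightarrow> ('b \<Rightarrow> 'a) \<Rightarrow> bool" where
  "admissible M1 M2 lam mu \<longleftrightarrow>
     fibring_pair M1 M2 lam mu \<and>
     (\<forall>x\<in>universe M1. lam x \<in> designated M2 \<longleftrightarrow> x \<in> designated M1) \<and>
     (\<forall>y\<in>universe M2. mu y \<in> designated M1 \<longleftrightarrow> y \<in> designated M2)"

definition fibred_signature :: "'c signature \<Rightarrow> 'd signature \<Rightarrow> ('c + 'd) signature" where
  "fibred_signature C1 C2 k = C1 k <+> C2 k"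

fun star_lam :: "('a \<Rightarrow> 'b) \<Rightarrow> 'a + 'b \<Rightarrow> 'b" where
  "star_lam lam (Inl x) = lam x"
| "star_lam lam (Inr y) = y"

fun star_mu :: "('b \<Rightarrow> 'a) \<Rightarrow> 'a + 'b \<Rightarrow> 'a" where
  "star_mu mu (Inl x) = x"
| "star_mu mu (Inr y) = mu y"

fun fibred_oper ::
    "('c, 'a) matrix \<Rightarrow> ('d, 'b) matrix \<Rightarrow> ('a \<Rightarrow> 'b) \<Rightarrow> ('b \<Rightarrow> 'a) \<Rightarrow>
     'c + 'd \<Rightarrow> ('a + 'b) list \<Rightarrow> 'a + 'b" where
  "fibred_oper M1 M2 lam mu (Inl c) xs = Inl (oper M1 c (map (star_mu mu) xs))"
| "fibred_oper M1 M2 lam mu (Inr c) xs = Inr (oper M2 c (map (star_lam lam) xs))"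

definition fibred_matrix ::
    "('c, 'a) matrix \<Rightarrow> ('d, 'b) matrix \<Rightarrow> ('a \<Rightarrow> 'b) \<Rightarrow> ('b \<Rightarrow> 'a) \<Rightarrow> ('c + 'd, 'a + 'b) matrix" where
  "fibred_matrix M1 M2 lam mu =
     \<lparr>universe = universe M1 <+> universe M2,
      oper = fibred_oper M1 M2 lam mu,
      designated = designated M1 <+> designated M2\<rparr>"

definition fibred_logic ::
    "'c signature \<Rightarrow> ('c, 'a) matrix \<Rightarrow> 'd signature \<Rightarrow> ('d, 'b) matrix \<Rightarrow>
     ('a \<Rightarrow> 'b) \<Rightarrow> ('b \<Rightarrow> 'a) \<Rightarrow> ('c + 'd) logic" where
  "fibred_logic C1 M1 C2 M2 lam mu =
     matrix_logic (fibred_signature C1 C2) (fibred_matrix M1 M2 lam mu)"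

lemma is_signature_fibred_signature:
  assumes "is_signature C1" "is_signature C2"
  shows "is_signature (fibred_signature C1 C2)"
  using assms unfolding is_signature_def disjoint_family_on_def fibred_signature_def
  by blast

lemma is_matrix_fibred_matrix:
  assumes "is_matrix C1 M1" "is_matrix C2 M2" "fibring_pair M1 M2 lam mu"
  shows "is_matrix (fibred_signature C1 C2) (fibred_matrix M1 M2 lam mu)"
proof -
  have mu: "star_mu mu z \<in> universe M1" and lam: "star_lam lam z \<in> universe M2"
    if "z \<in> universe M1 <+> universe M2" for z
    using that assms(3) by (auto simp: fibring_pair_def)
  show ?thesis
    unfolding is_matrix_def
  proof (intro conjI allI ballI impI)
    fix k c xs
    assume c: "c \<in> fibred_signature C1 C2 k"
      and xs: "length xs = k \<and> set xs \<subseteq> universe (fibred_matrix M1 M2 lam mu)"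
    have 1: "set (map (star_mu mu) xs) \<subseteq> universe M1"
      using xs mu by (auto simp: fibred_matrix_def)
    have 2: "set (map (star_lam lam) xs) \<subseteq> universe M2"
      using xs lam by (auto simp: fibred_matrix_def)
    have 3: "oper M1 c1 (map (star_mu mu) xs) \<in> universe M1" if "c1 \<in> C1 k" for c1
      using assms(1) that xs 1 unfolding is_matrix_def by (metis length_map)
    have 4: "oper M2 c2 (map (star_lam lam) xs) \<in> universe M2" if "c2 \<in> C2 k" for c2
      using assms(2) that xs 2 unfolding is_matrix_def by (metis length_map)
    show "oper (fibred_matrix M1 M2 lam mu) c xs \<in> universe (fibred_matrix M1 M2 lam mu)"
      using c 3 4 by (auto simp: fibred_signature_def fibred_matrix_def)
  next
    show "designated (fibred_matrix M1 M2 lam mu) \<subseteq> universe (fibred_matrix M1 M2 lam mu)"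
      using assms(1,2) by (auto simp: is_matrix_def fibred_matrix_def)
  qed
qed

lemma inj_map_fm_inclusion: "inj (map_fm Inl)" "inj (map_fm Inr)"
  by (simp_all add: fm.inj_map)

lemma map_fm_Inl_in_L: "t \<in> L C1 \<Longrightarrow> map_fm Inl t \<in> L (fibred_signature C1 C2)"
  by (induction rule: L.induct)
     (auto simp: fibred_signature_def intro!: L.intros)

lemma map_fm_Inr_in_L: "t \<in> L C2 \<Longrightarrow> map_fm Inr t \<in> L (fibred_signature C1 C2)"
  by (induction rule: L.induct)
     (auto simp: fibred_signature_def intro!: L.intros)

end

theory Submission
  imports Defs
begin

text \<open>
  Each component matrix \<open>M\<^sub>i\<close> is a retract of the fibred matrix, the retraction being \<open>star_mu mu\<close>
  for \<open>i = 1\<close> and \<open>star_lam lam\<close> for \<open>i = 2\<close>. Admissibility says that the retraction preserves and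
  reflects designation, and the definition of the fibred operations makes it a homomorphism for
  the connectives of \<open>C\<^sub>i\<close>. So composing with the retraction turns fibred valuations into
  \<open>M\<^sub>i\<close>-valuations that agree with them on designation, and every \<open>M\<^sub>i\<close>-valuation arises in this
  way: embed its values at the variables and extend freely.
\<close>

text \<open>The free extension of an assignment \<open>s\<close> of the variables. It is total on
  raw terms; only its values on well-formed ones matter.\<close>

primrec eval :: "('c, 'a) matrix \<Rightarrow> (nat \<Rightarrow> 'a) \<Rightarrow> 'c fm \<Rightarrow> 'a" where
  "eval M s (Var i) = s i"
| "eval M s (App c ts) = oper M c (map (eval M s) ts)"

lemma eval_in_universe:
  assumes "t \<in> L C" "is_matrix C M" "range s \<subseteq> universe M"
  shows "eval M s t \<in> universe M"
  using assms(1)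
proof induction
  case (Var i)
  then show ?case using assms(3) by auto
next
  case (App c k ts)
  then have "set (map (eval M s) ts) \<subseteq> universe M" "length (map (eval M s) ts) = k"
    by auto
  then show ?case using App.hyps(1) assms(2) by (simp add: is_matrix_def)
qed

lemma valuation_eval:
  assumes "is_matrix C M" "range s \<subseteq> universe M"
  shows "valuation C M (eval M s)"
  using assms by (auto simp: valuation_def intro: eval_in_universe)

lemma valuation_in_universe: "valuation C M v \<Longrightarrow> t \<in> L C \<Longrightarrow> v t \<in> universe M"
  by (auto simp: valuation_def)

lemma valuation_App:
  "valuation C M v \<Longrightarrow> c \<in> C k \<Longrightarrow> length ts = k \<Longrightarrow> set ts \<subseteq> L C \<Longrightarrow>
    v (App c ts) = oper M c (map v ts)"
  by (auto simp: valuation_def)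

text \<open>Isolates what the two components share, so that one argument serves both.
  \<open>r\<close> is the retraction, and its section \<open>j\<close> supplies values for
  variables.\<close>

locale matrix_retract =
  fixes C :: "'c signature" and M :: "('c, 'a) matrix"
    and C' :: "'d signature" and M' :: "('d, 'b) matrix"
    and e :: "'c \<Rightarrow> 'd" and j :: "'a \<Rightarrow> 'b" and r :: "'b \<Rightarrow> 'a"
  assumes matrix: "is_matrix C' M'"
    and e_in: "c \<in> C k \<Longrightarrow> e c \<in> C' k"
    and j_in: "x \<in> universe M \<Longrightarrow> j x \<in> universe M'"
    and r_in: "y \<in> universe M' \<Longrightarrow> r y \<in> universe M"
    and r_j: "x \<in> universe M \<Longrightarrow> r (j x) = x"
    and r_designated: "y \<in> universe M' \<Longrightarrow> r y \<in> designated M \<longleftrightarrow> y \<in> designated M'"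
    and r_oper: "c \<in> C k \<Longrightarrow> length ys = k \<Longrightarrow> set ys \<subseteq> universe M' \<Longrightarrow>
      r (oper M' (e c) ys) = oper M c (map r ys)"
begin

lemma map_fm_in_L: "t \<in> L C \<Longrightarrow> map_fm e t \<in> L C'"
  by (induction rule: L.induct) (auto intro!: L.intros e_in)

lemma valuation_retract:
  assumes v: "valuation C' M' v"
  shows "valuation C M (\<lambda>t. r (v (map_fm e t)))"
  unfolding valuation_def
proof (intro conjI allI ballI impI)
  show "(\<lambda>t. r (v (map_fm e t))) \<in> L C \<rightarrow> universe M"
    using v by (auto intro: r_in valuation_in_universe map_fm_in_L)
next
  fix k c ts
  assume c: "c \<in> C k" and ts: "length ts = k \<and> set ts \<subseteq> L C"
  let ?us = "map (map_fm e) ts"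
  have us: "length ?us = k" "set ?us \<subseteq> L C'"
    using ts map_fm_in_L by auto
  \<comment> \<open>\<open>r_oper\<close> speaks only of arguments in the universe, so their
    membership comes first.\<close>
  have "set (map v ?us) \<subseteq> universe M'"
    using us(2) valuation_in_universe[OF v] by auto
  then have "r (oper M' (e c) (map v ?us)) = oper M c (map r (map v ?us))"
    using c us(1) by (intro r_oper) auto
  then show "r (v (map_fm e (App c ts))) = oper M c (map (\<lambda>t. r (v (map_fm e t))) ts)"
    using valuation_App[OF v e_in[OF c] us] by (simp add: comp_def)
qed

text \<open>The uniqueness half of the freeness of \<open>L C\<close>; \<open>valuation_eval\<close>
  is the existence half.\<close>

lemma valuations_agree:
  assumes "t \<in> L C" "valuation C M v" "valuation C M w" "\<And>i. v (Var i) = w (Var i)"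
  shows "v t = w t"
  using assms(1)
proof induction
  case (App c k ts)
  then have "set ts \<subseteq> L C" "map v ts = map w ts" by auto
  with App.hyps show ?case
    using valuation_App[OF assms(2)] valuation_App[OF assms(3)] by metis
qed (simp add: assms(4))

lemma valuation_lift:
  assumes v: "valuation C M v"
  obtains w where "valuation C' M' w" "\<And>t. t \<in> L C \<Longrightarrow> r (w (map_fm e t)) = v t"
proof
  have var: "v (Var i) \<in> universe M" for i
    using v by (rule valuation_in_universe) (rule L.Var)
  let ?w = "eval M' (\<lambda>i. j (v (Var i)))"
  show w: "valuation C' M' ?w"
    using matrix by (rule valuation_eval) (auto intro: j_in var)
  \<comment> \<open>Both sides are \<open>M\<close>-valuations in \<open>t\<close>, so it suffices
    to compare them at variables, where \<open>r_j\<close> cancels \<open>j\<close>.\<close>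
  show "r (?w (map_fm e t)) = v t" if "t \<in> L C" for t
    using that valuation_retract[OF w] v by (rule valuations_agree) (simp add: r_j var)
qed

text \<open>The forward direction retracts each \<open>M'\<close>-valuation, the backward one lifts
  each \<open>M\<close>-valuation. In both, \<open>r_designated\<close> transfers the premises and
  the conclusion.\<close>

lemma entails_iff:
  assumes "\<Gamma> \<subseteq> L C" "\<phi> \<in> L C"
  shows "entails C M \<Gamma> \<phi> \<longleftrightarrow> entails C' M' (map_fm e ` \<Gamma>) (map_fm e \<phi>)"
proof -
  have des: "r (w (map_fm e t)) \<in> designated M \<longleftrightarrow> w (map_fm e t) \<in> designated M'"
    if "valuation C' M' w" "t \<in> L C" for w t
    using that by (auto intro!: r_designated valuation_in_universe map_fm_in_L)
  have fwd: "entails C' M' (map_fm e ` \<Gamma>) (map_fm e \<phi>)" if ent: "entails C M \<Gamma> \<phi>"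
    unfolding entails_def
  proof (intro conjI allI impI)
    fix w assume w: "valuation C' M' w" and "w ` map_fm e ` \<Gamma> \<subseteq> designated M'"
    then have "(\<lambda>t. r (w (map_fm e t))) ` \<Gamma> \<subseteq> designated M"
      using des assms(1) by fastforce
    then have "r (w (map_fm e \<phi>)) \<in> designated M"
      using ent valuation_retract[OF w] by (auto simp: entails_def)
    then show "w (map_fm e \<phi>) \<in> designated M'"
      using des[OF w assms(2)] by simp
  qed (use assms map_fm_in_L in auto)
  have bwd: "entails C M \<Gamma> \<phi>" if ent: "entails C' M' (map_fm e ` \<Gamma>) (map_fm e \<phi>)"
    unfolding entails_def
  proof (intro conjI allI impI)
    fix v assume v: "valuation C M v" and "v ` \<Gamma> \<subseteq> designated M"
    obtain w where w: "valuation C' M' w" "\<And>t. t \<in> L C \<Longrightarrow> r (w (map_fm e t)) = v t"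
      using valuation_lift[OF v] by blast
    have des': "v t \<in> designated M \<longleftrightarrow> w (map_fm e t) \<in> designated M'" if "t \<in> L C" for t
      using des[OF w(1) that] w(2)[OF that] by simp
    have "w ` map_fm e ` \<Gamma> \<subseteq> designated M'"
      using \<open>v ` \<Gamma> \<subseteq> designated M\<close> assms(1) des' by auto
    then show "v \<phi> \<in> designated M"
      using ent w(1) des'[OF assms(2)] by (auto simp: entails_def)
  qed (use assms in auto)
  show ?thesis using fwd bwd by blast
qed

lemma strong_conservative_extension:
  "strong_conservative_extension e (matrix_logic C M) (matrix_logic C' M')"
  by (simp add: strong_conservative_extension_def matrix_logic_def entails_iff)

end

theorem proposition3p9:
  fixes C1 :: "'c signature" and C2 :: "'d signature"
    and M1 :: "('c, 'a) matrix" and M2 :: "('d, 'b) matrix"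
    and lam :: "'a \<Rightarrow> 'b" and mu :: "'b \<Rightarrow> 'a"
  assumes "is_signature C1" and "is_signature C2"
    and "is_matrix C1 M1" and "is_matrix C2 M2"
    and "admissible M1 M2 lam mu"
  shows "strong_conservative_extension Inl (matrix_logic C1 M1) (fibred_logic C1 M1 C2 M2 lam mu) \<and>
         strong_conservative_extension Inr (matrix_logic C2 M2) (fibred_logic C1 M1 C2 M2 lam mu)"
proof -
  let ?C = "fibred_signature C1 C2" and ?M = "fibred_matrix M1 M2 lam mu"
  have matrix: "is_matrix ?C ?M"
    using assms by (intro is_matrix_fibred_matrix) (simp_all add: admissible_def)
  \<comment> \<open>\<open>r_designated\<close> is immediate on \<open>Inl x\<close>; on
    \<open>Inr y\<close> it is the admissibility condition on \<open>mu\<close>.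
    \<open>r_oper\<close> holds because \<open>star_mu mu\<close> strips the tag \<open>Inl\<close>
    from the result of a fibred operation.\<close>
  interpret M1: matrix_retract C1 M1 ?C ?M Inl Inl "star_mu mu"
    using matrix assms(5)
    by unfold_locales
      (auto simp: fibred_signature_def fibred_matrix_def admissible_def fibring_pair_def)
  \<comment> \<open>Symmetric, now with the admissibility condition on \<open>lam\<close>.\<close>
  interpret M2: matrix_retract C2 M2 ?C ?M Inr Inr "star_lam lam"
    using matrix assms(5)
    by unfold_locales
      (auto simp: fibred_signature_def fibred_matrix_def admissible_def fibring_pair_def)
  show ?thesis
    unfolding fibred_logic_def
    using M1.strong_conservative_extension M2.strong_conservative_extension by blast
qed

end
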